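(* Let $\theta:\mathbb{R}^m\to\,]-\infty,\infty]$ be CPWL, let $\Phi:\mathbb{R}^n\times\mathbb{R}^d\to\mathbb{R}^m$, and let $\psi=\theta\circ\Phi$ be a fully amenable composition at $(\bar x,\bar w)\in\mathbb{R}^n\times\mathbb{R}^d$, finite at $(\bar x,\bar w)$, with $\bar z:=\Phi(\bar x,\bar w)$. Let $S(\bar z)$ be the linear subspace parallel to $\operatorname{aff}\partial\theta(\bar z)$, let $s=\dim S(\bar z)$, and let $B$ be the $s\times m$ reduction matrix of $\theta$ at $\bar z$ (as defined in the context). Then the second-order qualification condition $$S(\bar z)\cap\ker\nabla_x\Phi(\bar x,\bar w)^*=\{0\}$$ holds if and only if $(\bar x,\bar w)$ is a partial nondegenerate point of $\Phi$ in $x$ relative to the linear mapping $h(z)=Bz$, i.e., $$\nabla_x\Phi(\bar x,\bar w)\mathbb{R}^n+\ker B=\mathbb{R}^m.$$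
   Context: CPWL: $\theta:\mathbb{R}^m\to\,]-\infty,\infty]$ is convex piecewise linear (CPWL) if $\operatorname{dom}\theta=\{z:\theta(z)<\infty\}$ is nonempty and $\operatorname{epi}\theta$ is a convex polyhedron. $\partial\theta$ is the subdifferential of convex analysis, and $\partial^\infty\theta(\bar z)=\{v:(v,0)\in N((\bar z,\theta(\bar z));\operatorname{epi}\theta)\}$ (for convex $\theta$ this equals the normal cone $N(\bar z;\operatorname{dom}\theta)$). Fully amenable composition (for this setting): $\theta$ is CPWL, $\Phi$ is $\mathcal{C}^2$-smooth around $(\bar x,\bar w)$, $\bar z=\Phi(\bar x,\bar w)\in\operatorname{dom}\theta$, and $\partial^\infty\theta(\bar z)\cap\ker\nabla_x\Phi(\bar x,\bar w)^*=\{0\}$. Reduction matrix: let $A$ be an $m\times m$ matrix of a linear isometry (orthogonal matrix) of $\mathbb{R}^m=\mathbb{R}^s\times\mathbb{R}^{m-s}$ such that $A^*(S(\bar z))=\mathbb{R}^s\times\{0\}$; $B$ is the $s\times m$ matrix obtained from $A^{-1}$ by deleting its last $m-s$ rows. Partial nondegeneracy: $(\bar x,\bar w)$ is a partial nondegenerate point of $\Phi$ in $x$ relative to a smooth $h:\mathbb{R}^m\to\mathbb{R}^s$ if $\nabla_x\Phi(\bar x,\bar w)\mathbb{R}^n+\ker\nabla h(\bar z)=\mathbb{R}^m$. *)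

theory Defs
  imports
    "Jordan_Normal_Form.Matrix"
    "HOL-Analysis.Analysis"
begin

no_notation Matrix.vec_index (infixl \<open>$\<close> 100)

text \<open>
  \<open>\<real>\<^sup>n\<close>, \<open>\<real>\<^sup>d\<close> and \<open>\<real>\<^sup>m\<close> are \<open>real ^ 'n\<close>, \<open>real ^ 'd\<close> and \<open>real ^ 'm\<close>.  The dimension
  \<open>s\<close> below is a value that depends on \<open>\<theta>\<close> and may be \<open>0\<close>, so it cannot be the cardinality of
  a type: vectors in \<open>\<real>\<^sup>s\<close> and matrices of size \<open>s \<times> m\<close> are vectors and matrices in the sense of
  \<open>Jordan_Normal_Form\<close>, whose sizes are natural numbers.
\<close>

section \<open>Convex analysis of extended-real-valued functions\<close>

definition edom :: "('a \<Rightarrow> ereal) \<Rightarrow> 'a set"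
  where "edom \<theta> = {z. \<theta> z < \<infinity>}"

definition epi :: "('a \<Rightarrow> ereal) \<Rightarrow> ('a \<times> real) set"
  where "epi \<theta> = {(z, t). \<theta> z \<le> ereal t}"

text \<open>The first conjunct says that \<open>\<theta>\<close> takes values in \<open>]-\<infinity>, \<infinity>]\<close>.\<close>

definition cpwl :: "('a::euclidean_space \<Rightarrow> ereal) \<Rightarrow> bool"
  where "cpwl \<theta> \<longleftrightarrow> (\<forall>z. \<theta> z \<noteq> -\<infinity>) \<and> edom \<theta> \<noteq> {} \<and> polyhedron (epi \<theta>)"

definition subdiff :: "('a::real_inner \<Rightarrow> ereal) \<Rightarrow> 'a \<Rightarrow> 'a set"
  where "subdiff \<theta> p =
    (if \<bar>\<theta> p\<bar> = \<infinity> then {} else {v. \<forall>z. \<theta> p + ereal (v \<bullet> (z - p)) \<le> \<theta> z})"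

text \<open>The normal cone of convex analysis; it is only applied to convex sets (epigraphs of CPWL
  functions).\<close>

definition normal_cone :: "'a::real_inner \<Rightarrow> 'a set \<Rightarrow> 'a set"
  where "normal_cone p C = (if p \<in> C then {v. \<forall>q\<in>C. v \<bullet> (q - p) \<le> 0} else {})"

definition singular_subdiff :: "('a::real_inner \<Rightarrow> ereal) \<Rightarrow> 'a \<Rightarrow> 'a set"
  where "singular_subdiff \<theta> p =
    (if \<bar>\<theta> p\<bar> = \<infinity> then {} else {v. (v, 0) \<in> normal_cone (p, real_of_ereal (\<theta> p)) (epi \<theta>)})"

text \<open>The subspace \<open>S(p)\<close> parallel to the affine hull of \<open>\<partial>\<theta>(p)\<close>.  It exists and is unique as soon
  as \<open>\<partial>\<theta>(p)\<close> is nonempty, which is the case for CPWL \<open>\<theta>\<close> and \<open>p\<close> in its domain.\<close>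

definition parallel_subspace :: "('a::real_inner \<Rightarrow> ereal) \<Rightarrow> 'a \<Rightarrow> 'a set"
  where "parallel_subspace \<theta> p =
    (THE L. subspace L \<and> affine_parallel (affine hull subdiff \<theta> p) L)"

section \<open>Smoothness, partial derivatives and amenable compositions\<close>

definition C1_on :: "'a set \<Rightarrow> ('a::real_normed_vector \<Rightarrow> 'b::real_normed_vector)
    \<Rightarrow> ('a \<Rightarrow> 'a \<Rightarrow>\<^sub>L 'b) \<Rightarrow> bool"
  where "C1_on U f f' \<longleftrightarrow>
    (\<forall>q\<in>U. (f has_derivative blinfun_apply (f' q)) (at q)) \<and> continuous_on U f'"

definition C2_around :: "('a::real_normed_vector \<Rightarrow> 'b::real_normed_vector) \<Rightarrow> 'a \<Rightarrow> bool"
  where "C2_around f p \<longleftrightarrow>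
    (\<exists>U f' f''. open U \<and> p \<in> U \<and> C1_on U f f' \<and> C1_on U f' f'')"

definition deriv_x :: "('x::real_normed_vector \<times> 'w \<Rightarrow> 'b::real_normed_vector)
    \<Rightarrow> 'x \<times> 'w \<Rightarrow> 'x \<Rightarrow> 'b"
  where "deriv_x \<Phi> p = frechet_derivative (\<lambda>x. \<Phi> (x, snd p)) (at (fst p))"

definition fully_amenable :: "(real ^ 'm \<Rightarrow> ereal) \<Rightarrow> ((real ^ 'n) \<times> (real ^ 'd) \<Rightarrow> real ^ 'm)
    \<Rightarrow> (real ^ 'n) \<times> (real ^ 'd) \<Rightarrow> bool"
  where "fully_amenable \<theta> \<Phi> p \<longleftrightarrow>
    cpwl \<theta> \<and> C2_around \<Phi> p \<and> \<Phi> p \<in> edom \<theta> \<and>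
    singular_subdiff \<theta> (\<Phi> p) \<inter> adjoint (deriv_x \<Phi> p) -` {0} = {0}"

section \<open>Reduction matrix and partial nondegeneracy\<close>

text \<open>The linear order on \<open>'m\<close> plays the role of the order of the coordinates \<open>1, \<dots>, m\<close>:
  \<open>coord i\<close>, for \<open>i < m\<close>, is the coordinate in position \<open>i\<close>, counted from \<open>0\<close>.\<close>

definition coord :: "nat \<Rightarrow> 'm::{finite, linorder}"
  where "coord i = sorted_list_of_set UNIV ! i"

text \<open>The subspace \<open>\<real>\<^sup>s \<times> {0}\<close> of \<open>\<real>\<^sup>m = \<real>\<^sup>s \<times> \<real>\<^bsup>m-s\<^esup>\<close>.\<close>

definition leading_subspace :: "nat \<Rightarrow> (real ^ 'm::{finite, linorder}) set"
  where "leading_subspace s = {y. \<forall>i. s \<le> i \<and> i < CARD('m) \<longrightarrow> y $ coord i = 0}"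

text \<open>The matrix of size \<open>s \<times> m\<close> formed by the first \<open>s\<close> rows of \<open>M\<close>.\<close>

definition first_rows :: "nat \<Rightarrow> real ^ 'm::{finite, linorder} ^ 'm::{finite, linorder} \<Rightarrow> real Matrix.mat"
  where "first_rows s M = Matrix.mat s CARD('m) (\<lambda>(i, j). M $ coord i $ coord j)"

definition reduction_matrix :: "(real ^ 'm::{finite, linorder} \<Rightarrow> ereal) \<Rightarrow> real ^ 'm::{finite, linorder}
    \<Rightarrow> real Matrix.mat \<Rightarrow> bool"
  where "reduction_matrix \<theta> p B \<longleftrightarrow>
    (let S = parallel_subspace \<theta> p; s = dim S in
      \<exists>A :: real ^ 'm::{finite, linorder} ^ 'm::{finite, linorder}. orthogonal_matrix A \<and>
        (\<lambda>v. transpose A *v v) ` S = leading_subspace s \<and>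
        B = first_rows s (matrix_inv A))"

definition to_vec :: "real ^ 'm::{finite, linorder} \<Rightarrow> real Matrix.vec"
  where "to_vec z = Matrix.vec CARD('m) (\<lambda>i. z $ coord i)"

definition apply_mat :: "real Matrix.mat \<Rightarrow> real ^ 'm::{finite, linorder} \<Rightarrow> real Matrix.vec"
  where "apply_mat B z = B *\<^sub>v to_vec z"

definition ker_mat :: "real Matrix.mat \<Rightarrow> (real ^ 'm::{finite, linorder}) set"
  where "ker_mat B = {z. apply_mat B z = 0\<^sub>v (dim_row B)}"

text \<open>Since \<open>Matrix.vec\<close> is not a normed space, smoothness and the derivative of
  \<open>h : \<real>\<^sup>m \<rightarrow> \<real>\<^sup>s\<close> are taken component by component.\<close>

definition smooth_map :: "nat \<Rightarrow> ('a::real_normed_vector \<Rightarrow> real Matrix.vec) \<Rightarrow> bool"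
  where "smooth_map s h \<longleftrightarrow>
    (\<forall>z. h z \<in> carrier_vec s) \<and> (\<forall>i<s. \<exists>h'. C1_on UNIV (\<lambda>z. Matrix.vec_index (h z) i) h')"

definition ker_deriv :: "nat \<Rightarrow> ('a::real_normed_vector \<Rightarrow> real Matrix.vec) \<Rightarrow> 'a \<Rightarrow> 'a set"
  where "ker_deriv s h p =
    {v. \<forall>i<s. frechet_derivative (\<lambda>z. Matrix.vec_index (h z) i) (at p) v = 0}"

text \<open>\<open>+\<close> is the sum of sets.\<close>

definition partial_nondegenerate :: "((real ^ 'n) \<times> (real ^ 'd) \<Rightarrow> real ^ 'm)
    \<Rightarrow> (real ^ 'n) \<times> (real ^ 'd) \<Rightarrow> nat \<Rightarrow> (real ^ 'm \<Rightarrow> real Matrix.vec) \<Rightarrow> bool"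
  where "partial_nondegenerate \<Phi> p s h \<longleftrightarrow>
    smooth_map s h \<and> range (deriv_x \<Phi> p) + ker_deriv s h (\<Phi> p) = UNIV"

end

theory Submission
  imports Defs
begin

text \<open>
  Since \<open>A\<close> is orthogonal, \<open>A\<^sup>-\<^sup>1 = A\<^sup>*\<close>, and \<open>A\<^sup>*\<close> maps \<open>S\<close> onto the span of the first \<open>s\<close>
  coordinates; hence the kernel of \<open>B\<close>, formed by the first \<open>s\<close> rows of \<open>A\<^sup>*\<close>, is the orthogonal
  complement of \<open>S\<close>.  The equivalence is then finite-dimensional duality: the orthogonal complement
  of \<open>range D + S\<^sup>\<bottom>\<close> is \<open>ker D\<^sup>* \<inter> S\<close>, where \<open>D\<close> is the partial derivative of \<open>\<Phi>\<close>.
\<close>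

lemma orthogonal_comp_set_plus:
  fixes V W :: "'a::real_inner set"
  assumes "0 \<in> V" "0 \<in> W"
  shows "(V + W)\<^sup>\<bottom> = V\<^sup>\<bottom> \<inter> W\<^sup>\<bottom>"
proof
  have "V \<subseteq> V + W" "W \<subseteq> V + W"
    using assms by (metis add_0_right set_plus_intro subsetI, metis add_0_left set_plus_intro subsetI)
  then show "(V + W)\<^sup>\<bottom> \<subseteq> V\<^sup>\<bottom> \<inter> W\<^sup>\<bottom>"
    using orthogonal_comp_anti_mono by blast
  show "V\<^sup>\<bottom> \<inter> W\<^sup>\<bottom> \<subseteq> (V + W)\<^sup>\<bottom>"
    by (auto simp: orthogonal_comp_def orthogonal_def set_plus_def inner_add_left)
qed

lemma subspace_set_plus:
  assumes "subspace V" "subspace W"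
  shows "subspace (V + W)"
proof -
  have "V + W = {x + y |x y. x \<in> V \<and> y \<in> W}"
    by (auto simp: set_plus_def)
  with subspace_sums[OF assms] show ?thesis by simp
qed

text \<open>In finite dimension a subspace is its own double complement, so \<open>T\<close> can be
  recovered from its complement. This turns a spanning condition into a trivial-intersection
  condition.\<close>

lemma orthogonal_comp_eq_zero_iff:
  fixes T :: "'a::euclidean_space set"
  assumes "subspace T"
  shows "T\<^sup>\<bottom> = {0} \<longleftrightarrow> T = UNIV"
  using orthogonal_comp_self[OF assms] by (metis orthogonal_comp_UNIV orthogonal_comp_null)

lemma set_plus_orthogonal_comp_eq_UNIV_iff:
  fixes D :: "'a::euclidean_space \<Rightarrow> 'b::euclidean_space"
  assumes D: "linear D" and S: "subspace S"
  shows "range D + S\<^sup>\<bottom> = UNIV \<longleftrightarrow> S \<inter> adjoint D -` {0} = {0}"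
proof -
  have R: "subspace (range D)"
    using D linear_subspace_image subspace_UNIV by blast
  have "(range D + S\<^sup>\<bottom>)\<^sup>\<bottom> = (range D)\<^sup>\<bottom> \<inter> S"
    using R S subspace_orthogonal_comp[of S]
    by (simp add: orthogonal_comp_set_plus subspace_0 orthogonal_comp_self)
  \<comment> \<open>The kernel of a linear map is the complement of the range of its adjoint; for
    \<open>adjoint D\<close> that adjoint is \<open>D\<close> again.\<close>
  also have "(range D)\<^sup>\<bottom> = adjoint D -` {0}"
    using ker_orthogonal_comp_adjoint[OF adjoint_linear[OF D]] D by (simp add: adjoint_adjoint)
  finally show ?thesis
    using orthogonal_comp_eq_zero_iff[OF subspace_set_plus[OF R subspace_orthogonal_comp], of S]
    by (simp add: Int_commute)
qed

lemma matrix_inv_orthogonal: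
  fixes A :: "real ^ 'm::finite ^ 'm::finite"
  assumes "orthogonal_matrix A"
  shows "matrix_inv A = transpose A"
proof -
  have A: "transpose A ** A = mat 1" "A ** transpose A = mat 1"
    using assms by (auto simp: orthogonal_matrix_def)
  \<comment> \<open>\<open>matrix_inv\<close> is a choice of a two-sided inverse;
    \<open>transpose A\<close> witnesses that one exists, and uniqueness of inverses then identifies
    the two.\<close>
  then have "A ** matrix_inv A = mat 1 \<and> matrix_inv A ** A = mat 1"
    unfolding matrix_inv_def by (intro someI) blast
  then show ?thesis
    by (metis A(1) matrix_mul_assoc matrix_mul_lid matrix_mul_rid)
qed

text \<open>Dictionary between the numeric positions that index \<open>Matrix.mat\<close> and the
  elements of \<open>'m\<close> that index \<open>real ^ 'm\<close>; sums are transported along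
  it.\<close>

lemma bij_betw_coord:
  "bij_betw (coord :: nat \<Rightarrow> 'm::{finite, linorder}) {..<CARD('m)} UNIV"
proof -
  have "bij_betw ((!) (sorted_list_of_set (UNIV :: 'm set)))
      {..<length (sorted_list_of_set (UNIV :: 'm set))} (set (sorted_list_of_set (UNIV :: 'm set)))"
    by (rule bij_betw_nth) auto
  then show ?thesis
    by (simp add: coord_def[abs_def])
qed

lemma coord_eq_iff:
  assumes "i < CARD('m)" "j < CARD('m)"
  shows "(coord i :: 'm::{finite, linorder}) = coord j \<longleftrightarrow> i = j"
  using bij_betw_coord[where 'm = 'm] assms
  by (auto simp: bij_betw_def dest: inj_onD)

lemma sum_coord:
  fixes f :: "'m::{finite, linorder} \<Rightarrow> 'a::comm_monoid_add"
  shows "(\<Sum>i<CARD('m). f (coord i)) = sum f UNIV"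
  using sum.reindex_bij_betw[OF bij_betw_coord] .

lemma inner_coord:
  fixes x y :: "real ^ 'm::{finite, linorder}"
  shows "x \<bullet> y = (\<Sum>i<CARD('m). x $ coord i * y $ coord i)"
  unfolding inner_vec_def by (simp add: sum_coord[of "\<lambda>k. x $ k * y $ k"])

lemma subspace_leading_subspace: "subspace (leading_subspace s)"
  by (auto simp: subspace_def leading_subspace_def)

lemma orthogonal_comp_leading_subspace:
  assumes "s \<le> CARD('m)"
  shows "(leading_subspace s :: (real ^ 'm::{finite, linorder}) set)\<^sup>\<bottom> =
    {z. \<forall>i<s. z $ coord i = 0}" (is "?L\<^sup>\<bottom> = ?K")
proof
  show "?L\<^sup>\<bottom> \<subseteq> ?K"
  proof clarify
    fix z i assume z: "z \<in> ?L\<^sup>\<bottom>" and i: "i < s"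
    \<comment> \<open>The bound on \<open>s\<close> makes \<open>i\<close> a genuine position, so by
      injectivity of \<open>coord\<close> this unit vector vanishes at all positions from
      \<open>s\<close> on.\<close>
    then have "axis (coord i) 1 \<in> ?L"
      using assms by (auto simp: leading_subspace_def axis_def coord_eq_iff)
    with z show "z $ coord i = 0"
      by (auto simp: orthogonal_comp_def orthogonal_def inner_axis inner_commute)
  qed
  show "?K \<subseteq> ?L\<^sup>\<bottom>"
  proof
    fix z assume z: "z \<in> ?K"
    have "y \<bullet> z = 0" if "y \<in> ?L" for y
      unfolding inner_coord
    proof (rule sum.neutral, rule ballI)
      fix i assume "i \<in> {..<CARD('m)}"
      with z that show "y $ coord i * z $ coord i = 0"
        by (cases "i < s") (auto simp: leading_subspace_def)
    qed
    then show "z \<in> ?L\<^sup>\<bottom>"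
      by (simp add: orthogonal_comp_def orthogonal_def)
  qed
qed

lemma vec_index_apply_mat:
  fixes z :: "real ^ 'm::{finite, linorder}"
  assumes "i < dim_row B"
  shows "Matrix.vec_index (apply_mat B z) i =
    (\<Sum>j<CARD('m). Matrix.vec_index (Matrix.row B i) j * z $ coord j)"
  using assms
  by (simp add: apply_mat_def to_vec_def scalar_prod_def lessThan_atLeast0)

lemma ker_mat_iff:
  "z \<in> ker_mat B \<longleftrightarrow> (\<forall>i<dim_row B. Matrix.vec_index (apply_mat B z) i = 0)"
  by (simp add: ker_mat_def apply_mat_def Matrix.vec_eq_iff)

text \<open>Reindexing along \<open>coord\<close> identifies the products of the two matrix
  libraries entry by entry.\<close>

lemma ker_mat_first_rows:
  fixes M :: "real ^ 'm::{finite, linorder} ^ 'm::{finite, linorder}"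
  shows "ker_mat (first_rows s M) = {z. \<forall>i<s. (M *v z) $ coord i = 0}"
proof -
  have "Matrix.vec_index (apply_mat (first_rows s M) z) i = (M *v z) $ coord i"
    if "i < s" for i and z :: "real ^ 'm::{finite, linorder}"
    using that sum_coord[of "\<lambda>k. M $ coord i $ k * z $ k"]
    by (simp add: vec_index_apply_mat first_rows_def matrix_vector_mult_def)
  then show ?thesis
    by (auto simp: ker_mat_iff) (auto simp: first_rows_def)
qed

lemma bounded_linear_vec_index_apply_mat:
  assumes "i < dim_row B"
  shows "bounded_linear (\<lambda>z :: real ^ 'm::{finite, linorder}. Matrix.vec_index (apply_mat B z) i)"
  unfolding vec_index_apply_mat[OF assms]
  by (intro bounded_linear_sum bounded_linear_const_mult bounded_linear_vec_nth)

text \<open>Such a map is its own derivative at every point, so the derivative is constant and hence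
  continuous.\<close>

lemma C1_on_bounded_linear:
  assumes "bounded_linear f"
  shows "C1_on U f (\<lambda>_. Blinfun f)"
  using assms
  by (simp add: C1_on_def bounded_linear_Blinfun_apply bounded_linear_imp_has_derivative)

lemma smooth_map_apply_mat:
  "smooth_map (dim_row B) (apply_mat B :: real ^ 'm::{finite, linorder} \<Rightarrow> _)"
  unfolding smooth_map_def
proof (intro conjI allI impI)
  show "apply_mat B z \<in> carrier_vec (dim_row B)" for z :: "real ^ 'm::{finite, linorder}"
    by (simp add: apply_mat_def carrier_vecI)
  show "\<exists>h'. C1_on UNIV (\<lambda>z :: real ^ 'm::{finite, linorder}. Matrix.vec_index (apply_mat B z) i) h'"
    if "i < dim_row B" for i
    using C1_on_bounded_linear[OF bounded_linear_vec_index_apply_mat[OF that]] by blast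
qed

lemma ker_deriv_apply_mat:
  fixes p :: "real ^ 'm::{finite, linorder}"
  shows "ker_deriv (dim_row B) (apply_mat B) p = ker_mat B"
proof -
  have "frechet_derivative (\<lambda>z. Matrix.vec_index (apply_mat B z) i) (at p) v =
      Matrix.vec_index (apply_mat B v) i" if "i < dim_row B" for i v
    using frechet_derivative_at[OF bounded_linear_imp_has_derivative[OF
        bounded_linear_vec_index_apply_mat[OF that]], of p]
    by (rule fun_cong[OF sym])
  then show ?thesis
    by (auto simp: ker_deriv_def ker_mat_iff)
qed

text \<open>\<open>S\<close> is a subspace as the image of \<open>\<real>\<^sup>s \<times> {0}\<close> under \<open>A\<close>, so the definite description in
  \<open>parallel_subspace\<close> is never unfolded.\<close>

lemma reduction_matrix_props:
  fixes \<theta> :: "real ^ 'm::{finite, linorder} \<Rightarrow> ereal"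
  assumes "reduction_matrix \<theta> p B"
  defines "S \<equiv> parallel_subspace \<theta> p"
  shows "subspace S" "dim_row B = dim S" "ker_mat B = S\<^sup>\<bottom>"
proof -
  define L :: "(real ^ 'm::{finite, linorder}) set" where "L = leading_subspace (dim S)"
  obtain A :: "real ^ 'm::{finite, linorder} ^ 'm::{finite, linorder}" where A: "orthogonal_matrix A"
    and AL: "(\<lambda>v. transpose A *v v) ` S = L"
    and B: "B = first_rows (dim S) (matrix_inv A)"
    using assms by (auto simp: reduction_matrix_def L_def Let_def)
  \<comment> \<open>Undoing \<open>transpose A\<close> expresses \<open>S\<close> as the image of
    the leading subspace under \<open>A\<close>.\<close>
  have inv: "A *v (transpose A *v v) = v" for v
    using A by (simp add: matrix_vector_mul_assoc orthogonal_matrix_def del: transpose_matrix_vector)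
  then have S: "S = (\<lambda>v. A *v v) ` L"
    by (simp add: AL[symmetric] image_image del: transpose_matrix_vector)
  have "subspace L"
    by (simp add: L_def subspace_leading_subspace)
  then show "subspace S"
    unfolding S by (rule linear_subspace_image[rotated]) simp
  show "dim_row B = dim S"
    by (simp add: B first_rows_def)
  have adj: "(A *v y) \<bullet> z = y \<bullet> (transpose A *v z)" for y z
    by (metis dot_lmul_matrix inner_commute vector_transpose_matrix)
  have "dim S \<le> CARD('m)"
    using dim_subset_UNIV[of S] by simp
  \<comment> \<open>The rows of \<open>B\<close> are the first rows of \<open>transpose A\<close>;
    vanishing of the first \<open>dim S\<close> coordinates is orthogonality to
    \<open>L\<close>.\<close>
  then have "ker_mat B = {z. transpose A *v z \<in> L\<^sup>\<bottom>}"
    by (simp add: B matrix_inv_orthogonal[OF A] L_def ker_mat_first_rows orthogonal_comp_leading_subspace)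
  also have "\<dots> = S\<^sup>\<bottom>"
    by (simp add: S orthogonal_comp_def orthogonal_def adj)
  finally show "ker_mat B = S\<^sup>\<bottom>" .
qed

text \<open>\<open>frechet_derivative\<close> is a choice, so linearity needs an actual derivative:
  the partial map is \<Phi> composed with the affine embedding of the first factor at fixed
  \<open>snd p\<close>.\<close>

lemma linear_deriv_x:
  assumes "\<Phi> differentiable (at p)"
  shows "linear (deriv_x \<Phi> p)"
proof -
  have "(\<Phi> \<circ> (\<lambda>x. (x, snd p))) differentiable (at (fst p))"
  proof (rule differentiable_chain_at)
    show "(\<lambda>x. (x, snd p)) differentiable (at (fst p))"
      using has_derivative_Pair[OF has_derivative_ident has_derivative_const]
      by (rule differentiableI)
  qed (simp add: assms)
  then show ?thesis
    unfolding deriv_x_def by (intro linear_frechet_derivative) (simp add: o_def)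
qed

lemma C2_around_imp_differentiable:
  assumes "C2_around f p"
  shows "f differentiable (at p)"
  using assms by (auto simp: C2_around_def C1_on_def differentiable_def)

theorem theorem3p2:
  fixes \<theta> :: "real ^ 'm::{finite, linorder} \<Rightarrow> ereal"
    and \<Phi> :: "(real ^ 'n) \<times> (real ^ 'd) \<Rightarrow> real ^ 'm::{finite, linorder}"
    and xbar :: "real ^ 'n" and wbar :: "real ^ 'd"
    and zbar :: "real ^ 'm::{finite, linorder}"
    and S :: "(real ^ 'm::{finite, linorder}) set" and s :: nat
    and B :: "real Matrix.mat"
  assumes "cpwl \<theta>"
    and "fully_amenable \<theta> \<Phi> (xbar, wbar)"
    and "\<bar>(\<theta> \<circ> \<Phi>) (xbar, wbar)\<bar> \<noteq> \<infinity>"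
    and "zbar = \<Phi> (xbar, wbar)"
    and "S = parallel_subspace \<theta> zbar"
    and "s = dim S"
    and "reduction_matrix \<theta> zbar B"
  shows "(S \<inter> adjoint (deriv_x \<Phi> (xbar, wbar)) -` {0} = {0} \<longleftrightarrow>
      partial_nondegenerate \<Phi> (xbar, wbar) s (apply_mat B)) \<and>
    (partial_nondegenerate \<Phi> (xbar, wbar) s (apply_mat B) \<longleftrightarrow>
      range (deriv_x \<Phi> (xbar, wbar)) + ker_mat B = UNIV)"
proof -
  have D: "linear (deriv_x \<Phi> (xbar, wbar))"
    using assms(2) by (intro linear_deriv_x C2_around_imp_differentiable)
      (simp add: fully_amenable_def)
  have S: "subspace S" and s: "dim_row B = s" and K: "ker_mat B = S\<^sup>\<bottom>"
    using reduction_matrix_props[OF assms(7)] assms(5,6) by simp_all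
  \<comment> \<open>The components of \<open>apply_mat B\<close> are linear, so smoothness is
    automatic and the kernel of the derivative is \<open>ker_mat B\<close> at every point.\<close>
  have "partial_nondegenerate \<Phi> (xbar, wbar) s (apply_mat B) \<longleftrightarrow>
      range (deriv_x \<Phi> (xbar, wbar)) + ker_mat B = UNIV"
    using s by (auto simp: partial_nondegenerate_def smooth_map_apply_mat ker_deriv_apply_mat)
  then show ?thesis
    using set_plus_orthogonal_comp_eq_UNIV_iff[OF D S] by (simp add: K)
qed

end
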